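(* There exists no polynomial-time algorithm that returns a quasi-$1$-exact $(1+\varepsilon)$-approximation set for every biobjective optimization problem instance and every $\varepsilon>0$, and that generates feasible solutions only by solving $\mathrm{Gap}_\delta(b)$ for points $b$ of polynomial encoding size and polynomial values of $\frac1\delta$.
   Context: An instance $(X,f)$ of a biobjective optimization problem consists of a set $X$ of feasible solutions and $f=(f_1,f_2)$, $f_i:X\to\mathbb{Q}_{>0}$, both to be minimized. The set $X$ need not be given explicitly. Standing assumption: there is a positive integer $M$, bounded by a polynomial in the encoding length of the instance, such that the binary encoding length of $f_i(x)$ is at most $M$ for all $x\in X$ and $i=1,2$. Gap problem $\mathrm{Gap}_\delta(b)$: given the instance $(X,f)$, a point $b\in\mathbb{Q}^2$ and $\delta>0$, either return a feasible solution $x\in X$ with $f_i(x)\le b_i$ for $i=1,2$, or answer correctly ("NO") that there is no $x'\in X$ with $f_i(x')\le\frac{b_i}{1+\delta}$ for $i=1,2$. If both kinds of answer are correct, either may be given. An algorithm "generates feasible solutions only by solving $\mathrm{Gap}_\delta(b)$" if its only access to the feasible set $X$ is through queries $\mathrm{Gap}_\delta(b)$, each answered by an arbitrary correct answer (the algorithm must succeed for every choice of correct answers); it can output only solutions returned by such queries. "Polynomial" for the running time, the encoding size of $b$, and the value $\frac1\delta$ means bounded by a polynomial in the encoding size of the input (instance) and in $\frac1\varepsilon$. A quasi-$1$-exact $(1+\varepsilon)$-approximation set is a set $P\subseteq X$ such that for every $x'\in X$ there is $x\in P$ with $f_i(x)\le(1+\varepsilon)f_i(x')$ for $i=1,2$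 and $f_j(x)\le f_j(x')$ for at least one $j\in\{1,2\}$. *)

theory Defs
  imports "HOL-Computational_Algebra.Polynomial" "HOL-Library.Log_Nat"
begin

section \<open>Binary encodings\<close>

datatype symbol = Blank | Sep | Bit bool

text \<open>Least significant bit first, no leading zeros; \<open>0\<close> is the empty word.\<close>

definition binary :: "nat \<Rightarrow> bool list" where
  "binary n = map (bit n) [0..<floorlog 2 n]"

text \<open>A rational in lowest terms: the sign followed by the numerator, and the denominator.\<close>

definition rat_words :: "rat \<Rightarrow> bool list list" where
  "rat_words r = (case quotient_of r of (n, d) \<Rightarrow> [(n < 0) # binary (nat \<bar>n\<bar>), binary (nat d)])"

definition rat_size :: "rat \<Rightarrow> nat" where
  "rat_size r = sum_list (map length (rat_words r))"

definition pair_size :: "rat \<times> rat \<Rightarrow> nat" where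
  "pair_size b = rat_size (fst b) + rat_size (snd b)"

definition tape_word :: "bool list list \<Rightarrow> symbol list" where
  "tape_word us = concat (map (\<lambda>u. map Bit u @ [Sep]) us)"

definition load :: "bool list list \<Rightarrow> nat \<Rightarrow> symbol" where
  "load us i = (if i < length (tape_word us) then tape_word us ! i else Blank)"

text \<open>Words on a tape can be read back unambiguously.\<close>

lemma tape_word_inj: "tape_word us = tape_word vs \<Longrightarrow> us = vs"
proof (induction us arbitrary: vs)
  case Nil
  then show ?case by (cases vs) (auto simp: tape_word_def)
next
  case (Cons u us)
  then obtain v vs' where vs: "vs = v # vs'"
    by (cases vs) (auto simp: tape_word_def)
  have split: "map Bit u @ Sep # s = map Bit v @ Sep # t \<Longrightarrow> u = v \<and> s = t" for v s t
  proof (induction u arbitrary: v)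
    case Nil then show ?case by (cases v) auto
  next
    case (Cons a u) then show ?case by (cases v) auto
  qed
  show ?case using Cons split by (auto simp: vs tape_word_def)
qed

lemma load_inj: "load us = load vs \<Longrightarrow> us = vs"
proof -
  assume eq: "load us = load vs"
  have nb: "Blank \<notin> set (tape_word ws)" for ws by (auto simp: tape_word_def)
  have len: "{i. load ws i \<noteq> Blank} = {..<length (tape_word ws)}" for ws
    using nb[of ws] by (auto simp: load_def) (metis nth_mem)
  have "length (tape_word us) = length (tape_word vs)"
    using len[of us] len[of vs] eq by simp
  moreover have "tape_word us ! i = tape_word vs ! i" if "i < length (tape_word us)" for i
    using fun_cong[OF eq, of i] that calculation by (simp add: load_def)
  ultimately show "us = vs" by (intro tape_word_inj nth_equalityI)
qed

lemma rat_words_inj: "rat_words r = rat_words s \<Longrightarrow> r = s"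
proof -
  assume eq: "rat_words r = rat_words s"
  have bin: "m = n" if b: "binary m = binary n" for m n :: nat
  proof (rule bit_eqI)
    fix i
    have zero: "\<not> bit k i" if "floorlog 2 k \<le> i" for k :: nat
    proof -
      have "k < 2 ^ floorlog 2 k"
        using floorlog_bounds[of k 2] by (cases "k = 0") auto
      also have "\<dots> \<le> 2 ^ i" using that by simp
      finally show ?thesis by (simp add: bit_iff_odd)
    qed
    have len: "floorlog 2 m = floorlog 2 n"
      using arg_cong[OF b, of length] by (simp add: binary_def)
    show "bit m i \<longleftrightarrow> bit n i"
    proof (cases "i < floorlog 2 n")
      case True
      then show ?thesis
        using arg_cong[OF b, of "\<lambda>l. l ! i"] len by (simp add: binary_def)
    qed (use zero len in auto)
  qed
  obtain n d where q: "quotient_of r = (n, d)" by force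
  obtain n' d' where q': "quotient_of s = (n', d')" by force
  have pos: "d > 0" "d' > 0" using q q' quotient_of_denom_pos by auto
  have "nat \<bar>n\<bar> = nat \<bar>n'\<bar>" "nat d = nat d'" "(n < 0) = (n' < 0)"
    using eq bin by (auto simp: rat_words_def q q')
  then have "n = n'" "d = d'" using pos by (auto simp: abs_if split: if_splits)
  then show "r = s" using q q' by (metis quotient_of_inject)
qed


section \<open>Biobjective minimization problems\<close>

text \<open>
  A problem assigns to every instance, given by its encoding (a bit string), a feasible set, a pair
  of objective functions and the bound \<open>M\<close> on the encoding length of objective values. Solutions
  are bit strings too. The meaning of an instance string is arbitrary and depends on the problem,
  so that an algorithm that works for all problems learns nothing about the feasible set from it.
\<close>

type_synonym solution = "bool list"

record problem =
  instances :: "bool list set"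
  feasible :: "bool list \<Rightarrow> solution set"
  objective :: "bool list \<Rightarrow> solution \<Rightarrow> rat \<times> rat"
  value_bound :: "bool list \<Rightarrow> nat"

definition leq2 :: "rat \<times> rat \<Rightarrow> rat \<times> rat \<Rightarrow> bool" where
  "leq2 y b \<longleftrightarrow> fst y \<le> fst b \<and> snd y \<le> snd b"

definition scale2 :: "rat \<Rightarrow> rat \<times> rat \<Rightarrow> rat \<times> rat" where
  "scale2 c b = (c * fst b, c * snd b)"

text \<open>
  The polynomial bound on the length of solutions is the usual requirement that a solution can be
  written down in polynomial time; without it the impossibility would hold for trivial reasons.
\<close>

definition biobjective_problem :: "problem \<Rightarrow> bool" where
  "biobjective_problem \<Pi> \<longleftrightarrow>
     (\<forall>w \<in> instances \<Pi>. value_bound \<Pi> w > 0 \<and>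
        (\<forall>x \<in> feasible \<Pi> w. \<forall>v \<in> {fst (objective \<Pi> w x), snd (objective \<Pi> w x)}.
           v > 0 \<and> rat_size v \<le> value_bound \<Pi> w)) \<and>
     (\<exists>p :: nat poly. \<forall>w \<in> instances \<Pi>. value_bound \<Pi> w \<le> poly p (length w)) \<and>
     (\<exists>p :: nat poly. \<forall>w \<in> instances \<Pi>. \<forall>x \<in> feasible \<Pi> w. length x \<le> poly p (length w))"

definition quasi_1_exact_approx ::
    "solution set \<Rightarrow> (solution \<Rightarrow> rat \<times> rat) \<Rightarrow> rat \<Rightarrow> solution set \<Rightarrow> bool" where
  "quasi_1_exact_approx X f \<epsilon> P \<longleftrightarrow> P \<subseteq> X \<and>
     (\<forall>x' \<in> X. \<exists>x \<in> P. leq2 (f x) (scale2 (1 + \<epsilon>) (f x')) \<and>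
        (fst (f x) \<le> fst (f x') \<or> snd (f x) \<le> snd (f x')))"

text \<open>The point \<open>b\<close> and the value \<open>\<delta>\<close>.\<close>

type_synonym gap_query = "(rat \<times> rat) \<times> rat"

text \<open>\<open>None\<close> is the answer NO.\<close>

fun gap_answer ::
    "solution set \<Rightarrow> (solution \<Rightarrow> rat \<times> rat) \<Rightarrow> gap_query \<Rightarrow> solution option \<Rightarrow> bool" where
  "gap_answer X f (b, \<delta>) (Some x) \<longleftrightarrow> x \<in> X \<and> leq2 (f x) b"
| "gap_answer X f (b, \<delta>) None \<longleftrightarrow> \<not> (\<exists>x' \<in> X. leq2 (f x') (scale2 (1 / (1 + \<delta>)) b))"


section \<open>Deterministic oracle Turing machines\<close>

datatype tape = Input | Query | Answer | Output | Work

datatype move = Left | Stay | Right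

record machine =
  num_states :: nat
  start_state :: nat
  halt_state :: nat
  query_state :: nat
  resume_state :: nat
  transition :: "nat \<Rightarrow> (tape \<Rightarrow> symbol) \<Rightarrow> nat \<times> (tape \<Rightarrow> symbol \<times> move)"

definition oracle_machine :: "machine \<Rightarrow> bool" where
  "oracle_machine A \<longleftrightarrow>
     {start_state A, halt_state A, query_state A, resume_state A} \<subseteq> {..<num_states A} \<and>
     query_state A \<noteq> halt_state A \<and>
     (\<forall>q < num_states A. \<forall>s. fst (transition A q s) < num_states A)"

text \<open>
  Tapes are infinite to the right only. The trace records the gap queries made so far and
  their answers.
\<close>

record config =
  cur_state :: nat
  cells :: "tape \<Rightarrow> nat \<Rightarrow> symbol"
  head_pos :: "tape \<Rightarrow> nat"
  trace :: "(gap_query \<times> solution option) list"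

fun move_head :: "move \<Rightarrow> nat \<Rightarrow> nat" where
  "move_head Left i = i - 1"
| "move_head Stay i = i"
| "move_head Right i = i + 1"

fun query_words :: "gap_query \<Rightarrow> bool list list" where
  "query_words (b, \<delta>) = rat_words (fst b) @ rat_words (snd b) @ rat_words \<delta>"

lemma query_words_inj: "query_words q = query_words q' \<Longrightarrow> q = q'"
proof -
  assume eq: "query_words q = query_words q'"
  obtain b1 b2 d where q: "q = ((b1, b2), d)" by (metis prod.collapse)
  obtain b1' b2' d' where q': "q' = ((b1', b2'), d')" by (metis prod.collapse)
  have len: "length (rat_words r) = 2" for r by (simp add: rat_words_def split: prod.split)
  show "q = q'" using eq len by (auto simp: q q' dest!: rat_words_inj)
qed

text \<open>An answer comes with the objective values of the returned solution.\<close>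

fun answer_words :: "(solution \<Rightarrow> rat \<times> rat) \<Rightarrow> solution option \<Rightarrow> bool list list" where
  "answer_words f None = [[False]]"
| "answer_words f (Some x) = [True] # x # rat_words (fst (f x)) @ rat_words (snd (f x))"

text \<open>Only queries with \<open>\<delta> > 0\<close> are well-formed.\<close>

definition read_query :: "(nat \<Rightarrow> symbol) \<Rightarrow> gap_query option" where
  "read_query c = (if \<exists>q. snd q > 0 \<and> c = load (query_words q)
                   then Some (THE q. snd q > 0 \<and> c = load (query_words q)) else None)"

lemma read_query_load: "snd q > 0 \<Longrightarrow> read_query (load (query_words q)) = Some q"
proof -
  assume pos: "snd q > 0"
  have "q' = q" if "load (query_words q) = load (query_words q')" for q'
    using load_inj[OF that] query_words_inj by metis
  then have "(THE q'. snd q' > 0 \<and> load (query_words q) = load (query_words q')) = q"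
    using pos by (intro the_equality) auto
  then show ?thesis using pos unfolding read_query_def by metis
qed

definition initial :: "machine \<Rightarrow> bool list list \<Rightarrow> config" where
  "initial A us = \<lparr>cur_state = start_state A,
     cells = (\<lambda>\<tau>. load (if \<tau> = Input then us else [])), head_pos = (\<lambda>\<tau>. 0), trace = []\<rparr>"

text \<open>
  The \<open>k\<close>-th gap query \<open>q\<close> of a run is answered by \<open>ans k q\<close>. A query counts as one step;
  a malformed query is answered by an empty tape.
\<close>

definition step ::
    "machine \<Rightarrow> (solution \<Rightarrow> rat \<times> rat) \<Rightarrow> (nat \<Rightarrow> gap_query \<Rightarrow> solution option) \<Rightarrow> config \<Rightarrow> config" where
  "step A f ans c =
     (if cur_state c = halt_state A then c
      else if cur_state c = query_state A then
        (let (us, new) = (case read_query (cells c Query) of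
              None \<Rightarrow> ([], [])
            | Some q \<Rightarrow> (let a = ans (length (trace c)) q in (answer_words f a, [(q, a)])))
         in \<lparr>cur_state = resume_state A,
             cells = (cells c)(Query := load [], Answer := load us),
             head_pos = (head_pos c)(Query := 0, Answer := 0),
             trace = trace c @ new\<rparr>)
      else
        (let (q, act) = transition A (cur_state c) (\<lambda>\<tau>. cells c \<tau> (head_pos c \<tau>))
         in \<lparr>cur_state = q,
             cells = (\<lambda>\<tau>. (cells c \<tau>)(head_pos c \<tau> := fst (act \<tau>))),
             head_pos = (\<lambda>\<tau>. move_head (snd (act \<tau>)) (head_pos c \<tau>)),
             trace = trace c\<rparr>))"


section \<open>Algorithms based on the gap problem\<close>

text \<open>The machine is given the instance, the bound \<open>M\<close> and \<open>\<epsilon>\<close>.\<close>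

definition config_at ::
    "machine \<Rightarrow> problem \<Rightarrow> bool list \<Rightarrow> rat \<Rightarrow> (nat \<Rightarrow> gap_query \<Rightarrow> solution option) \<Rightarrow> nat \<Rightarrow> config" where
  "config_at A \<Pi> w \<epsilon> ans t =
     (step A (objective \<Pi> w) ans ^^ t) (initial A ([w, binary (value_bound \<Pi> w)] @ rat_words \<epsilon>))"

definition halted_at ::
    "machine \<Rightarrow> problem \<Rightarrow> bool list \<Rightarrow> rat \<Rightarrow> (nat \<Rightarrow> gap_query \<Rightarrow> solution option) \<Rightarrow> nat \<Rightarrow> bool" where
  "halted_at A \<Pi> w \<epsilon> ans t \<longleftrightarrow> cur_state (config_at A \<Pi> w \<epsilon> ans t) = halt_state A"

text \<open>The output tape of the configuration lists the elements of the set \<open>P\<close>.\<close>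

definition outputs :: "config \<Rightarrow> solution set \<Rightarrow> bool" where
  "outputs c P \<longleftrightarrow> (\<exists>xs. cells c Output = load xs \<and> P = set xs)"

text \<open>
  The inputs together with the possible behaviours of the gap oracle. As \<open>ans\<close> may answer the
  same query differently at different times, every sequence of correct answers is covered.
\<close>

definition admissible ::
    "problem \<Rightarrow> bool list \<Rightarrow> rat \<Rightarrow> (nat \<Rightarrow> gap_query \<Rightarrow> solution option) \<Rightarrow> bool" where
  "admissible \<Pi> w \<epsilon> ans \<longleftrightarrow> w \<in> instances \<Pi> \<and> \<epsilon> > 0 \<and>
     (\<forall>k b \<delta>. \<delta> > 0 \<longrightarrow> gap_answer (feasible \<Pi> w) (objective \<Pi> w) (b, \<delta>) (ans k (b, \<delta>)))"

text \<open>
  The value at the encoding size of the input and \<open>1 / \<epsilon>\<close> of the bivariate polynomial \<open>p\<close>,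
  viewed as a polynomial whose coefficients are polynomials. The size of \<open>\<epsilon>\<close> is included,
  since \<open>\<epsilon>\<close> cannot be read otherwise.
\<close>

definition input_bound :: "rat poly poly \<Rightarrow> bool list \<Rightarrow> rat \<Rightarrow> rat" where
  "input_bound p w \<epsilon> = poly (poly p [:of_nat (length w + rat_size \<epsilon>):]) (1 / \<epsilon>)"

definition polynomial_time :: "machine \<Rightarrow> bool" where
  "polynomial_time A \<longleftrightarrow> (\<forall>\<Pi>. biobjective_problem \<Pi> \<longrightarrow>
     (\<exists>p. \<forall>w \<epsilon> ans. admissible \<Pi> w \<epsilon> ans \<longrightarrow>
        (\<exists>t. of_nat t \<le> input_bound p w \<epsilon> \<and> halted_at A \<Pi> w \<epsilon> ans t)))"

definition polynomial_points :: "machine \<Rightarrow> bool" where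
  "polynomial_points A \<longleftrightarrow> (\<forall>\<Pi>. biobjective_problem \<Pi> \<longrightarrow>
     (\<exists>p. \<forall>w \<epsilon> ans. admissible \<Pi> w \<epsilon> ans \<longrightarrow>
        (\<forall>t. \<forall>((b, \<delta>), a) \<in> set (trace (config_at A \<Pi> w \<epsilon> ans t)).
           of_nat (pair_size b) \<le> input_bound p w \<epsilon>)))"

definition polynomial_inverse_gaps :: "machine \<Rightarrow> bool" where
  "polynomial_inverse_gaps A \<longleftrightarrow> (\<forall>\<Pi>. biobjective_problem \<Pi> \<longrightarrow>
     (\<exists>p. \<forall>w \<epsilon> ans. admissible \<Pi> w \<epsilon> ans \<longrightarrow>
        (\<forall>t. \<forall>((b, \<delta>), a) \<in> set (trace (config_at A \<Pi> w \<epsilon> ans t)).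
           1 / \<delta> \<le> input_bound p w \<epsilon>)))"

definition outputs_only_gap_solutions :: "machine \<Rightarrow> bool" where
  "outputs_only_gap_solutions A \<longleftrightarrow> (\<forall>\<Pi> w \<epsilon> ans t P.
     biobjective_problem \<Pi> \<and> admissible \<Pi> w \<epsilon> ans \<and> halted_at A \<Pi> w \<epsilon> ans t \<and>
     outputs (config_at A \<Pi> w \<epsilon> ans t) P \<longrightarrow>
     P \<subseteq> {x. \<exists>q. (q, Some x) \<in> set (trace (config_at A \<Pi> w \<epsilon> ans t))})"

definition returns_quasi_1_exact_approx :: "machine \<Rightarrow> bool" where
  "returns_quasi_1_exact_approx A \<longleftrightarrow> (\<forall>\<Pi> w \<epsilon> ans.
     biobjective_problem \<Pi> \<and> admissible \<Pi> w \<epsilon> ans \<longrightarrow>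
     (\<exists>t P. halted_at A \<Pi> w \<epsilon> ans t \<and> outputs (config_at A \<Pi> w \<epsilon> ans t) P \<and>
        quasi_1_exact_approx (feasible \<Pi> w) (objective \<Pi> w) \<epsilon> P))"

end

(*
  Two solutions suffice, with objective vectors (2^n + 1, 2^n + 1) and (2^n, 2^n) on inputs of
  length n. The first does not cover the second, being worse in both objectives. Since the ratio of
  the values is 1 + 1 / 2^n, an oracle may ignore the second solution in every query with
  1 / \<delta> \<le> 2^n: it returns the first solution whenever that one is below b, and NO is a correct
  answer otherwise. With polynomially bounded 1 / \<delta> the better solution is never seen for large n.
*)

theory Submission
  imports Defs "HOL-Real_Asymp.Real_Asymp"
begin

lemma poly_less_two_power:
  fixes r :: "rat poly"
  shows "\<exists>n. poly r (of_nat n) < 2 ^ n"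
proof -
  \<comment> \<open>The factor \<open>n ^ k\<close> serves the induction: the tail of
    \<open>pCons a r\<close> is multiplied by one more n, which raises k by one.\<close>
  have lim: "(\<lambda>n. real_of_rat (poly r (of_nat n)) * real n ^ k / 2 ^ n) \<longlonglongrightarrow> 0" for k
  proof (induction r arbitrary: k)
    case (pCons a r)
    have "(\<lambda>n. real n ^ k / 2 ^ n) \<longlonglongrightarrow> 0"
      by real_asymp
    from tendsto_add[OF tendsto_mult_right_zero[OF this, of "real_of_rat a"] pCons.IH[of "Suc k"]]
    show ?case
      by (simp add: of_rat_add of_rat_mult algebra_simps add_divide_distrib)
  qed simp
  from order_tendstoD(2)[OF lim[of 0], of 1]
  have "\<forall>\<^sub>F n in sequentially. real_of_rat (poly r (of_nat n)) < 2 ^ n"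
    by (simp add: divide_simps)
  then obtain n where "real_of_rat (poly r (of_nat n)) < 2 ^ n"
    using eventually_happens by fastforce
  also have "(2 :: real) ^ n = real_of_rat (2 ^ n)"
    by (simp add: of_rat_power)
  finally show ?thesis
    by (auto simp: of_rat_less)
qed

text \<open>Evaluating every coefficient at y leaves a polynomial in x alone.\<close>

lemma poly_poly_const:
  fixes p :: "'a :: comm_ring_1 poly poly"
  shows "\<exists>r. \<forall>x. poly (poly p [:x:]) y = poly r x"
proof (induction p)
  case 0
  show ?case
    by (intro exI[of _ 0]) simp
next
  case (pCons a p)
  then obtain r where "\<forall>x. poly (poly p [:x:]) y = poly r x"
    by blast
  then show ?case
    by (intro exI[of _ "pCons (poly a y) r"]) simp
qed

text \<open>For fixed \<epsilon>, both \<open>rat_size \<epsilon>\<close> and 1 / \<epsilon> are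
  constants, so the bound is a polynomial in the length of \<open>w\<close>.\<close>

lemma input_bound_less_two_power:
  "\<exists>n. \<forall>w. length w = n \<longrightarrow> input_bound p w \<epsilon> < 2 ^ n"
proof -
  obtain r where r: "poly (poly p [:x:]) (1 / \<epsilon>) = poly r x" for x
    using poly_poly_const[of p "1 / \<epsilon>"] by blast
  obtain n where "poly (pcompose r [:of_nat (rat_size \<epsilon>), 1:]) (of_nat n) < 2 ^ n"
    using poly_less_two_power by blast
  then show ?thesis
    by (intro exI[of _ n]) (auto simp: input_bound_def r poly_pcompose add.commute)
qed

lemma trace_answers:
  "(q, a) \<in> set (trace (config_at A \<Pi> w \<epsilon> ans t)) \<Longrightarrow> \<exists>k. a = ans k q"
proof (induction t)
  case 0
  then show ?case
    by (simp add: config_at_def initial_def)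
next
  case (Suc t)
  then show ?case
    by (auto simp: config_at_def step_def Let_def split: if_splits option.splits prod.splits)
qed

lemma rat_size_of_nat: "rat_size (of_nat m) = floorlog 2 m + 2"
proof -
  have "quotient_of (of_nat m) = (int m, 1)"
    using quotient_of_int[of "int m"] by simp
  then show ?thesis
    by (simp add: rat_size_def rat_words_def binary_def floorlog_eq_zero_iff compute_floorlog)
qed

definition close_value :: "bool list \<Rightarrow> solution \<Rightarrow> nat" where
  "close_value w x = (if x = [] then 2 ^ length w + 1 else 2 ^ length w)"

definition close_problem :: problem where
  "close_problem = \<lparr>instances = UNIV, feasible = (\<lambda>w. {[], [True]}),
     objective = (\<lambda>w x. (of_nat (close_value w x), of_nat (close_value w x))),
     value_bound = (\<lambda>w. length w + 4)\<rparr>"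

text \<open>The second case keeps the oracle correct for tiny \<delta>: b may miss the first
  solution while b / (1 + \<delta>) is still above the second, and then NO would be wrong.\<close>

definition hiding_answer :: "bool list \<Rightarrow> gap_query \<Rightarrow> solution option" where
  "hiding_answer w q =
     (if leq2 (objective close_problem w []) (fst q) then Some []
      else if leq2 (objective close_problem w [True]) (fst q) \<and> 2 ^ length w < 1 / snd q
      then Some [True] else None)"

lemma biobjective_close_problem: "biobjective_problem close_problem"
proof -
  have pos: "close_value w x > 0" for w x
    by (simp add: close_value_def)
  have size: "rat_size (of_nat (close_value w x)) \<le> length w + 4" for w x
  proof -
    \<comment> \<open>Sign and denominator take the other two bits. The bound
      \<open>length w + 1\<close> would fail for the empty \<open>w\<close>, where the value 2
      occurs.\<close>
    have "floorlog 2 (close_value w x) \<le> length w + 2"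
    proof (intro floorlog_leI)
      obtain m :: nat where "2 ^ length w = Suc m"
        using not0_implies_Suc[of "2 ^ length w"] by auto
      then show "close_value w x < 2 ^ (length w + 2)"
        by (simp add: close_value_def)
    qed simp_all
    then show ?thesis
      by (simp add: rat_size_of_nat)
  qed
  have "\<exists>p :: nat poly. \<forall>w :: bool list. length w + 4 \<le> poly p (length w)"
    by (intro exI[of _ "[:4, 1:]"]) simp
  moreover have "\<exists>p :: nat poly. \<forall>w :: bool list. Suc 0 \<le> poly p (length w)"
    by (intro exI[of _ "[:1:]"]) simp
  ultimately show ?thesis
    using pos size by (auto simp: biobjective_problem_def close_problem_def)
qed

lemma admissible_hiding_answer:
  assumes "\<epsilon> > 0"
  shows "admissible close_problem w \<epsilon> (\<lambda>_. hiding_answer w)"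
proof -
  have "gap_answer (feasible close_problem w) (objective close_problem w) (b, \<delta>)
          (hiding_answer w (b, \<delta>))" if "\<delta> > 0" for b \<delta>
  proof -
    define N :: rat where "N = 2 ^ length w"
    have N: "N \<ge> 1"
      by (simp add: N_def)
    \<comment> \<open>A solution that refutes NO lies below b itself.\<close>
    have mono: "v \<le> c" if "v \<le> c / (1 + \<delta>)" "v \<ge> 0" for v c
    proof -
      have "v + v * \<delta> \<le> c" "0 \<le> v * \<delta>"
        using that \<open>\<delta> > 0\<close> by (simp_all add: field_simps)
      then show ?thesis
        by linarith
    qed
    \<comment> \<open>Here N * \<delta> \<ge> 1, so N * (1 + \<delta>) \<le> c forces N + 1 \<le> c:
      whenever \<open>[True]\<close> would refute NO, the solution \<open>[]\<close> is below b and
      is returned instead.\<close>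
    have gap: "1 + N \<le> c" if "N \<le> c / (1 + \<delta>)" "\<not> N < 1 / \<delta>" for c
      using that \<open>\<delta> > 0\<close> by (simp add: field_simps)
    show ?thesis
      using N mono[of N] mono[of "1 + N"] gap
      by (auto simp: hiding_answer_def close_problem_def close_value_def leq2_def scale2_def
          simp flip: N_def)
  qed
  then show ?thesis
    using assms by (simp add: admissible_def close_problem_def)
qed

theorem theorem5p1:
  shows "\<not> (\<exists>A. oracle_machine A \<and>
            polynomial_time A \<and>
            returns_quasi_1_exact_approx A \<and>
            outputs_only_gap_solutions A \<and>
            polynomial_points A \<and>
            polynomial_inverse_gaps A)"
proof
  let ?\<Pi> = close_problem
  assume "\<exists>A. oracle_machine A \<and> polynomial_time A \<and> returns_quasi_1_exact_approx A \<and>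
            outputs_only_gap_solutions A \<and> polynomial_points A \<and> polynomial_inverse_gaps A"
  then obtain A where returns: "returns_quasi_1_exact_approx A"
    and only: "outputs_only_gap_solutions A" and gaps: "polynomial_inverse_gaps A"
    by blast
  \<comment> \<open>The polynomial depends on the problem only, so the length of the instance can be
    chosen after it.\<close>
  from gaps obtain p where p: "1 / \<delta> \<le> input_bound p w \<epsilon>"
    if "admissible ?\<Pi> w \<epsilon> ans" "((b, \<delta>), a) \<in> set (trace (config_at A ?\<Pi> w \<epsilon> ans t))"
    for w \<epsilon> ans t b \<delta> a
    using biobjective_close_problem unfolding polynomial_inverse_gaps_def by fast
  obtain n where n: "\<forall>w. length w = n \<longrightarrow> input_bound p w 1 < 2 ^ n"
    using input_bound_less_two_power by blast
  define w where "w = replicate n True"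
  let ?ans = "\<lambda>_ :: nat. hiding_answer w"
  have bound: "input_bound p w 1 < 2 ^ length w"
    using n by (simp add: w_def)
  have adm: "admissible ?\<Pi> w 1 ?ans"
    by (simp add: admissible_hiding_answer)
  obtain t P where halt: "halted_at A ?\<Pi> w 1 ?ans t" "outputs (config_at A ?\<Pi> w 1 ?ans t) P"
    and approx: "quasi_1_exact_approx (feasible ?\<Pi> w) (objective ?\<Pi> w) 1 P"
    using returns biobjective_close_problem adm unfolding returns_quasi_1_exact_approx_def by blast
  have "x = []" if "x \<in> P" for x
  proof -
    have "\<exists>q. (q, Some x) \<in> set (trace (config_at A ?\<Pi> w 1 ?ans t))"
      using that only biobjective_close_problem adm halt unfolding outputs_only_gap_solutions_def by blast
    then obtain b \<delta> where q: "((b, \<delta>), Some x) \<in> set (trace (config_at A ?\<Pi> w 1 ?ans t))"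
      by (metis prod.exhaust)
    then have "Some x = hiding_answer w (b, \<delta>)"
      using trace_answers by blast
    moreover have "\<not> 2 ^ length w < 1 / \<delta>"
      using p[OF adm q] bound by linarith
    ultimately show ?thesis
      by (simp add: hiding_answer_def split: if_splits)
  qed
  \<comment> \<open>Only exactness in one objective fails; the factor 1 + \<epsilon> = 2 is met by
    \<open>[]\<close>.\<close>
  moreover obtain x where "x \<in> P" "fst (objective ?\<Pi> w x) \<le> fst (objective ?\<Pi> w [True]) \<or>
      snd (objective ?\<Pi> w x) \<le> snd (objective ?\<Pi> w [True])"
    using approx by (auto simp: quasi_1_exact_approx_def close_problem_def)
  ultimately show False
    by (auto simp: close_problem_def close_value_def)
qed

end
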